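(* Let $E$ be a Hilbert space and let $\tau$ be a Hausdorff topology on $E$. Let $\{ T(t) : t \geq 0 \}$ be a one-parameter $\tau$-continuous semigroup of nonexpansive mappings on a bounded closed convex subset $C$ of $E$. Fix $\alpha, \beta > 0$ with $\alpha / \beta \notin \mathbb{Q}$. Let $u \in C$ and define a sequence $\{ x_n \}$ in $C$ (implicitly) by $$ x_n = \frac{1-\lambda_n}{2} T(\alpha) x_n + \frac{1-\lambda_n}{2} T(\beta) x_n + \lambda_n u $$ for $n \in \mathbb{N}$, where $\{ \lambda_n \}$ is a sequence in $(0,1)$ converging to $0$. Then $\{ x_n \}$ converges strongly to a common fixed point of $\{ T(t) : t \geq 0 \}$.
   Context: $\mathbb{N}$ is the set of positive integers and $\mathbb{Q}$ the set of rational numbers. The point $x_n$ is the unique fixed point in $C$ of the contraction $x \mapsto \frac{1-\lambda_n}{2} T(\alpha) x + \frac{1-\lambda_n}{2} T(\beta) x + \lambda_n u$ of $C$ (Banach contraction principle). Let $C$ be a subset of a Banach space $E$ and let $\tau$ be a Hausdorff topology on $E$ (not necessarily the norm topology). A family $\{T(t) : t \geq 0\}$ of mappings from $C$ into $C$ is called a one-parameter $\tau$-continuous semigroup of nonexpansive mappings on $C$ if: (sg 1) $T(s+t) = T(s) \circ T(t)$ for all $s, t \geq 0$; (sg 2) for each $x \in C$, the mapping $t \mapsto T(t)x$ from $[0,\infty)$ into $C$ is continuous with respect to $\tau$; (sg 3) for each $t \geq 0$, $T(t)$ is nonexpansive, i.e., $\|T(t)x - T(t)y\| \leq \|x-y\|$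 for all $x,y \in C$. (It is not required that $T(0)$ be the identity mapping.) A common fixed point of $\{T(t) : t \geq 0\}$ is a point $z \in C$ with $T(t)z = z$ for all $t \geq 0$. Strong convergence is convergence in norm. *)

theory Defs
  imports "HOL-Analysis.Analysis"
begin

text \<open>
  The topology \<open>\<tau>\<close> on the space is an explicit object, independent of the norm topology carried by
  the type. Only the values \<open>T t x\<close> with \<open>t \<ge> 0\<close> and \<open>x \<in> C\<close> are constrained. Nonexpansiveness is
  Lipschitz continuity with constant 1 for the norm distance. \<open>T 0\<close> need not be the identity.
\<close>

definition nonexpansive_semigroup ::
    "'e::banach topology \<Rightarrow> 'e set \<Rightarrow> (real \<Rightarrow> 'e \<Rightarrow> 'e) \<Rightarrow> bool" where
  "nonexpansive_semigroup \<tau> C T \<longleftrightarrow>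
     (\<forall>t\<ge>0. T t \<in> C \<rightarrow> C) \<and>
     (\<forall>s\<ge>0. \<forall>t\<ge>0. \<forall>x\<in>C. T (s + t) x = T s (T t x)) \<and>
     (\<forall>x\<in>C. continuous_map (top_of_set {0..}) (subtopology \<tau> C) (\<lambda>t. T t x)) \<and>
     (\<forall>t\<ge>0. 1-lipschitz_on C (T t))"

definition common_fixed_point :: "'e set \<Rightarrow> (real \<Rightarrow> 'e \<Rightarrow> 'e) \<Rightarrow> 'e \<Rightarrow> bool" where
  "common_fixed_point C T z \<longleftrightarrow> z \<in> C \<and> (\<forall>t\<ge>0. T t z = z)"

end

theory Submission
  imports Defs
begin

text \<open>
  Let \<open>S = (T \<alpha> + T \<beta>) / 2\<close>. Monotonicity of \<open>I - S\<close> shows that \<open>\<parallel>x\<^sub>n - u\<parallel>\<close> increases as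
  \<open>\<lambda>\<^sub>n\<close> decreases and that \<open>\<parallel>x\<^sub>m - x\<^sub>n\<parallel>\<^sup>2\<close> is at most the difference of the values of
  \<open>\<parallel>x - u\<parallel>\<^sup>2\<close>; so \<open>x\<close> is Cauchy without any weak compactness, and its limit \<open>z\<close> is fixed
  by \<open>S\<close>. The same argument gives \<open>T \<alpha>\<close> a fixed point; \<open>Fix (T \<alpha>)\<close> is closed, convex and
  invariant under \<open>T \<beta>\<close>, so \<open>T \<alpha>\<close> and \<open>T \<beta>\<close> have a common fixed point, and strict convexity of
  the norm makes \<open>z\<close> one too. Finally \<open>T (k \<alpha> - h \<beta>) z = z\<close> whenever \<open>k \<alpha> - h \<beta> \<ge> 0\<close>; these
  times are dense by Kronecker's theorem, and \<open>{t. T t z = z}\<close> is closed as \<open>\<tau>\<close> is Hausdorff.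
\<close>

section \<open>Implicit approximants of a nonexpansive map\<close>

text \<open>With \<open>d\<close> the difference of the two defects, squaring norm ((x - y) - d)
  \<le> norm (x - y) leaves d \<bullet> d \<le> 2 * (d \<bullet> (x - y)), and the left side is
  nonnegative.\<close>

lemma nonexpansive_defect_monotone:
  fixes S :: "'a::real_inner \<Rightarrow> 'a"
  assumes "1-lipschitz_on C S" "x \<in> C" "y \<in> C"
  shows "((x - S x) - (y - S y)) \<bullet> (x - y) \<ge> 0"
proof -
  define d where "d = (x - S x) - (y - S y)"
  have "norm (S x - S y) \<le> norm (x - y)"
    using lipschitz_onD[OF assms] by (simp add: dist_norm)
  moreover have "S x - S y = (x - y) - d"
    by (simp add: d_def)
  ultimately have "((x - y) - d) \<bullet> ((x - y) - d) \<le> (x - y) \<bullet> (x - y)"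
    by (simp add: norm_le)
  then have "d \<bullet> d \<le> 2 * (d \<bullet> (x - y))"
    by (simp add: inner_diff_left inner_diff_right inner_commute algebra_simps)
  then show ?thesis
    unfolding d_def using inner_ge_zero[of "(x - S x) - (y - S y)"] by linarith
qed

text \<open>The implicit equation makes the defect of an approximant a negative multiple of its
  displacement from \<open>u\<close>, so monotonicity of the defect becomes an inequality between
  the two displacements \<open>X\<close> and \<open>Y\<close>.\<close>

lemma approximant_dist_le:
  fixes S :: "'a::real_inner \<Rightarrow> 'a"
  assumes S: "1-lipschitz_on C S" "x \<in> C" "y \<in> C"
    and ab: "0 < a" "a \<le> b" "b < 1"
    and x: "x = (1 - a) *\<^sub>R S x + a *\<^sub>R u"
    and y: "y = (1 - b) *\<^sub>R S y + b *\<^sub>R u"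
  shows "(norm (x - y))\<^sup>2 \<le> (norm (x - u))\<^sup>2 - (norm (y - u))\<^sup>2"
proof -
  define X Y where "X = x - u" and "Y = y - u"
  define \<mu> \<nu> where "\<mu> = a / (1 - a)" and "\<nu> = b / (1 - b)"
  have \<mu>\<nu>: "0 < \<mu>" "\<mu> \<le> \<nu>"
    using ab by (auto simp: \<mu>_def \<nu>_def intro!: frac_le)
  have defect: "v - S v = - ((c / (1 - c)) *\<^sub>R (v - u))"
    if "c < 1" "v = (1 - c) *\<^sub>R S v + c *\<^sub>R u" for c v
  proof -
    have "(1 - c) *\<^sub>R (v - S v) = v - c *\<^sub>R v - (1 - c) *\<^sub>R S v"
      by (simp add: algebra_simps)
    also have "(1 - c) *\<^sub>R S v = v - c *\<^sub>R u"
      using that(2) by (simp add: algebra_simps)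
    finally have "(1 - c) *\<^sub>R (v - S v) = - (c *\<^sub>R (v - u))"
      by (simp add: algebra_simps)
    then have "(1 / (1 - c)) *\<^sub>R ((1 - c) *\<^sub>R (v - S v)) = (1 / (1 - c)) *\<^sub>R (- (c *\<^sub>R (v - u)))"
      by (rule arg_cong)
    then show ?thesis
      using that(1) by simp
  qed
  have "x - S x = - (\<mu> *\<^sub>R X)" "y - S y = - (\<nu> *\<^sub>R Y)"
    unfolding \<mu>_def \<nu>_def X_def Y_def using ab by (auto intro: defect[OF _ x] defect[OF _ y])
  moreover have "x - y = X - Y"
    by (simp add: X_def Y_def)
  ultimately have "(- (\<mu> *\<^sub>R X) - - (\<nu> *\<^sub>R Y)) \<bullet> (X - Y) \<ge> 0"
    using nonexpansive_defect_monotone[OF S] by simp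
  then have "\<mu> * (X \<bullet> X) + \<nu> * (Y \<bullet> Y) \<le> (\<mu> + \<nu>) * (X \<bullet> Y)"
    by (simp add: inner_diff_left inner_diff_right inner_commute algebra_simps)
  \<comment> \<open>Polarization: replace 2 * (X \<bullet> Y) by X \<bullet> X + Y \<bullet> Y - (X
    - Y) \<bullet> (X - Y).\<close>
  then have main: "(\<mu> + \<nu>) * ((X - Y) \<bullet> (X - Y)) \<le> (\<nu> - \<mu>) * (X \<bullet> X - Y \<bullet> Y)"
    by (simp add: inner_diff_left inner_diff_right inner_commute algebra_simps)
  have "(X - Y) \<bullet> (X - Y) \<le> X \<bullet> X - Y \<bullet> Y"
  \<comment> \<open>For equal weights the right side of \<open>main\<close> vanishes and X = Y.
    Otherwise \<open>main\<close> first shows X \<bullet> X - Y \<bullet> Y to be nonnegative; then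
    its factor can be enlarged to \<mu> + \<nu> and cancelled.\<close>
  proof (cases "\<mu> = \<nu>")
    case True
    then have "(X - Y) \<bullet> (X - Y) \<le> 0"
      using main \<mu>\<nu> by (simp add: mult_le_0_iff)
    then have "X = Y"
      using inner_gt_zero_iff[of "X - Y"] by (metis eq_iff_diff_eq_0 not_le)
    then show ?thesis
      by simp
  next
    case False
    have "0 \<le> (\<nu> - \<mu>) * (X \<bullet> X - Y \<bullet> Y)"
      by (rule order_trans[OF _ main]) (use \<mu>\<nu> in simp)
    then have "0 \<le> X \<bullet> X - Y \<bullet> Y"
      using False \<mu>\<nu> by (simp add: zero_le_mult_iff)
    then have "(\<nu> - \<mu>) * (X \<bullet> X - Y \<bullet> Y) \<le> (\<mu> + \<nu>) * (X \<bullet> X - Y \<bullet> Y)"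
      using \<mu>\<nu> by (intro mult_right_mono) auto
    then have "(\<mu> + \<nu>) * ((X - Y) \<bullet> (X - Y)) \<le> (\<mu> + \<nu>) * (X \<bullet> X - Y \<bullet> Y)"
      using main by linarith
    then show ?thesis
      using \<mu>\<nu> by simp
  qed
  then show ?thesis
    by (simp add: X_def Y_def power2_norm_eq_inner)
qed

lemma approximants_converge:
  fixes S :: "'a::{real_inner, complete_space} \<Rightarrow> 'a"
  assumes S: "1-lipschitz_on C S" "S \<in> C \<rightarrow> C" and C: "bounded C" "closed C"
    and xC: "\<And>n. x n \<in> C"
    and c: "\<And>n. 0 < c n" "\<And>n. c n < 1" "c \<longlonglongrightarrow> 0"
    and x: "\<And>n. x n = (1 - c n) *\<^sub>R S (x n) + c n *\<^sub>R u"
  shows "\<exists>z\<in>C. S z = z \<and> x \<longlonglongrightarrow> z"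
proof -
  define f where "f n = (norm (x n - u))\<^sup>2" for n
  have mono: "(norm (x m - x n))\<^sup>2 \<le> f m - f n" if "c m \<le> c n" for m n
    unfolding f_def using approximant_dist_le[OF S(1) xC xC c(1) that c(2) x x] .
  have dist: "(norm (x m - x n))\<^sup>2 \<le> \<bar>f m - f n\<bar>" for m n
    using mono[of m n] mono[of n m] by (cases "c m \<le> c n") (auto simp: norm_minus_commute)
  obtain B where B: "\<And>v. v \<in> C \<Longrightarrow> norm v \<le> B"
    using C(1) by (auto simp: bounded_iff)
  have "f n \<le> (B + norm u)\<^sup>2" for n
    unfolding f_def using norm_triangle_ineq4[of "x n" u] B[OF xC[of n]]
    by (intro power_mono) auto
  then have bdd: "bdd_above (range f)"
    by (auto simp: bdd_above_def)
  \<comment> \<open>The sequence \<open>c\<close> need not be monotone, so neither is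
    \<open>f\<close>. But for each fixed \<open>N\<close> eventually c n < c N, hence f n \<ge> f N;
    this suffices for convergence to the supremum.\<close>
  have "f \<longlonglongrightarrow> (SUP n. f n)"
  proof (rule order_tendstoI)
    fix a assume "a < (SUP n. f n)"
    then obtain N where N: "a < f N"
      using less_cSUP_iff[OF _ bdd] by auto
    have "\<forall>\<^sub>F n in sequentially. c n < c N"
      by (rule order_tendstoD(2)[OF c(3) c(1)])
    then show "\<forall>\<^sub>F n in sequentially. a < f n"
    proof eventually_elim
      case (elim n)
      then have "0 \<le> f n - f N"
        using mono[of n N] order_trans[OF zero_le_power2] by force
      then show ?case
        using N by simp
    qed
  next
    fix a assume a: "(SUP n. f n) < a"
    have "f n < a" for n
      using cSUP_upper[OF UNIV_I bdd, of n] a by (rule le_less_trans)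
    then show "\<forall>\<^sub>F n in sequentially. f n < a"
      by simp
  qed
  then have "Cauchy f"
    by (rule LIMSEQ_imp_Cauchy)
  have "Cauchy x"
  proof (rule CauchyI)
    fix e :: real assume "0 < e"
    then obtain M where M: "\<And>m n. m \<ge> M \<Longrightarrow> n \<ge> M \<Longrightarrow> \<bar>f m - f n\<bar> < e\<^sup>2"
      using CauchyD[OF \<open>Cauchy f\<close>, of "e\<^sup>2"] by auto
    have "norm (x m - x n) < e" if "m \<ge> M" "n \<ge> M" for m n
      using dist[of m n] M[OF that] \<open>0 < e\<close> by (auto intro: power2_less_imp_less)
    then show "\<exists>M. \<forall>m\<ge>M. \<forall>n\<ge>M. norm (x m - x n) < e"
      by blast
  qed
  then obtain z where z: "x \<longlonglongrightarrow> z"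
    using Cauchy_convergent_iff convergent_def by blast
  then have zC: "z \<in> C"
    using C(2) xC closed_sequentially by blast
  have "(\<lambda>n. S (x n)) \<longlonglongrightarrow> S z"
    using continuous_on_tendsto_compose[OF lipschitz_on_continuous_on[OF S(1)] z zC] xC by simp
  then have "(\<lambda>n. (1 - c n) *\<^sub>R S (x n) + c n *\<^sub>R u) \<longlonglongrightarrow> (1 - 0) *\<^sub>R S z + 0 *\<^sub>R u"
    by (intro tendsto_intros c(3))
  then have "x \<longlonglongrightarrow> S z"
    by (simp flip: x)
  then have "S z = z"
    using z LIMSEQ_unique by blast
  then show ?thesis
    using z zC by blast
qed

text \<open>Approximants with respect to any base point of \<open>C\<close> exist by the Banach
  contraction principle, and their limit is fixed.\<close>

lemma nonexpansive_fixed_point_exists: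
  fixes S :: "'a::{real_inner, complete_space} \<Rightarrow> 'a"
  assumes S: "1-lipschitz_on C S" "S \<in> C \<rightarrow> C"
    and C: "bounded C" "closed C" "convex C" "C \<noteq> {}"
  shows "\<exists>z\<in>C. S z = z"
proof -
  obtain u where u: "u \<in> C"
    using C(4) by blast
  \<comment> \<open>Any null sequence in (0,1) would do; the shift by 2 keeps c 0 below 1.\<close>
  define c where "c n = 1 / (real n + 2)" for n
  have c: "0 < c n" "c n < 1" for n
    by (auto simp: c_def)
  have c0: "c \<longlonglongrightarrow> 0"
    unfolding c_def by real_asymp
  have "\<exists>v\<in>C. v = (1 - c n) *\<^sub>R S v + c n *\<^sub>R u" for n
  proof -
    have "\<exists>!v\<in>C. (1 - c n) *\<^sub>R S v + c n *\<^sub>R u = v"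
    proof (rule Banach_fix)
      show "(\<lambda>v. (1 - c n) *\<^sub>R S v + c n *\<^sub>R u) ` C \<subseteq> C"
        using S(2) u c[of n] by (auto intro!: convexD[OF C(3)])
      show "dist ((1 - c n) *\<^sub>R S v + c n *\<^sub>R u) ((1 - c n) *\<^sub>R S w + c n *\<^sub>R u) \<le> (1 - c n) * dist v w"
        if "v \<in> C" "w \<in> C" for v w
        using lipschitz_onD[OF S(1) that] c[of n]
        by (simp add: dist_norm flip: scaleR_diff_right)
    qed (use C c[of n] in \<open>auto simp: complete_eq_closed\<close>)
    then obtain v where "v \<in> C" "(1 - c n) *\<^sub>R S v + c n *\<^sub>R u = v"
      by (elim ex1E conjE)
    from this(2)[symmetric] this(1) show ?thesis
      by (rule bexI)
  qed
  then have "\<forall>n. \<exists>v. v \<in> C \<and> v = (1 - c n) *\<^sub>R S v + c n *\<^sub>R u"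
    by blast
  from choice[OF this]
  obtain x where "\<And>n. x n \<in> C" "\<And>n. x n = (1 - c n) *\<^sub>R S (x n) + c n *\<^sub>R u"
    by blast
  from approximants_converge[OF S C(1,2) this(1) c c0 this(2)] show ?thesis
    by blast
qed

section \<open>Fixed point sets and common fixed points of two maps\<close>

lemma convex_fixed_points:
  fixes S :: "'a::real_inner \<Rightarrow> 'a"
  assumes S: "1-lipschitz_on C S" and C: "convex C"
  shows "convex {v \<in> C. S v = v}"
proof (rule convexI)
  fix a b :: 'a and s t :: real
  assume a: "a \<in> {v \<in> C. S v = v}" and b: "b \<in> {v \<in> C. S v = v}"
    and st: "0 \<le> s" "0 \<le> t" "s + t = 1"
  define z where "z = s *\<^sub>R a + t *\<^sub>R b"
  have zC: "z \<in> C"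
    using a b st by (auto simp: z_def intro: convexD[OF C])
  have s: "s = 1 - t"
    using st by simp
  \<comment> \<open>The weighted sum of squared distances to \<open>a\<close> and \<open>b\<close>
    is minimal exactly at \<open>z\<close>. Since S z is no farther than \<open>z\<close> from
    either fixed point, comparing w = S z with w = z forces S z = z.\<close>
  have eq: "s * ((w - a) \<bullet> (w - a)) + t * ((w - b) \<bullet> (w - b))
      = (w - z) \<bullet> (w - z) + s * t * ((a - b) \<bullet> (a - b))" for w
    unfolding z_def s
    by (simp add: inner_diff_left inner_diff_right inner_add_left inner_add_right inner_commute algebra_simps)
  have le: "(S z - v) \<bullet> (S z - v) \<le> (z - v) \<bullet> (z - v)" if "v \<in> {v \<in> C. S v = v}" for v
    using lipschitz_onD[OF S zC, of v] that by (simp add: dist_norm norm_le)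
  have "s * ((S z - a) \<bullet> (S z - a)) + t * ((S z - b) \<bullet> (S z - b))
      \<le> s * ((z - a) \<bullet> (z - a)) + t * ((z - b) \<bullet> (z - b))"
    using le[OF a] le[OF b] st by (intro add_mono mult_left_mono)
  then have "(S z - z) \<bullet> (S z - z) \<le> 0"
    unfolding eq by simp
  then have "S z = z"
    using inner_gt_zero_iff[of "S z - z"] by (metis eq_iff_diff_eq_0 not_le)
  with zC show "s *\<^sub>R a + t *\<^sub>R b \<in> {v \<in> C. S v = v}"
    by (simp add: z_def)
qed

lemma closed_fixed_points:
  fixes S :: "'a::real_normed_vector \<Rightarrow> 'a"
  assumes S: "1-lipschitz_on C S" and C: "closed C"
  shows "closed {v \<in> C. S v = v}"
proof -
  have "continuous_on C (\<lambda>v. S v - v)"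
    by (intro continuous_intros lipschitz_on_continuous_on[OF S])
  from continuous_closed_preimage_constant[OF this C, of 0] show ?thesis
    by simp
qed

text \<open>Commutation makes the fixed point set of \<open>A\<close> invariant under
  \<open>B\<close>, since A (B v) = B (A v) = B v; fixed point existence then applies to
  \<open>B\<close> on that set.\<close>

lemma commuting_nonexpansive_common_fixed_point:
  fixes A B :: "'a::{real_inner, complete_space} \<Rightarrow> 'a"
  assumes A: "1-lipschitz_on C A" "A \<in> C \<rightarrow> C" and B: "1-lipschitz_on C B" "B \<in> C \<rightarrow> C"
    and comm: "\<And>v. v \<in> C \<Longrightarrow> A (B v) = B (A v)"
    and C: "bounded C" "closed C" "convex C" "C \<noteq> {}"
  shows "\<exists>p\<in>C. A p = p \<and> B p = p"
proof -
  let ?F = "{v \<in> C. A v = v}"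
  have "\<exists>p\<in>?F. B p = p"
  proof (rule nonexpansive_fixed_point_exists)
    show "1-lipschitz_on ?F B"
      by (rule lipschitz_on_subset[OF B(1)]) auto
    show "B \<in> ?F \<rightarrow> ?F"
      using B(2) comm by auto
    show "bounded ?F"
      by (rule bounded_subset[OF C(1)]) auto
    show "?F \<noteq> {}"
      using nonexpansive_fixed_point_exists[OF A C] by blast
  qed (use convex_fixed_points[OF A(1) C(3)] closed_fixed_points[OF A(1) C(2)] in auto)
  then show ?thesis
    by blast
qed

lemma midpoint_nonexpansive:
  fixes A B :: "'a::real_normed_vector \<Rightarrow> 'a"
  assumes "1-lipschitz_on C A" "1-lipschitz_on C B"
  shows "1-lipschitz_on C (\<lambda>v. midpoint (A v) (B v))"
proof (rule lipschitz_onI)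
  fix v w assume vw: "v \<in> C" "w \<in> C"
  have "midpoint (A v) (B v) - midpoint (A w) (B w) = (1/2) *\<^sub>R ((A v - A w) + (B v - B w))"
    by (simp add: midpoint_def algebra_simps)
  then have "dist (midpoint (A v) (B v)) (midpoint (A w) (B w)) \<le> (dist (A v) (A w) + dist (B v) (B w)) / 2"
    using norm_triangle_ineq[of "A v - A w" "B v - B w"] by (simp add: dist_norm)
  then show "dist (midpoint (A v) (B v)) (midpoint (A w) (B w)) \<le> 1 * dist v w"
    using lipschitz_onD[OF assms(1) vw] lipschitz_onD[OF assms(2) vw] by simp
qed simp

text \<open>Parallelogram law: \<open>a\<close> and \<open>b\<close> are no longer than their
  midpoint z - p, so the squared norm of a - b, which is 2 * (a \<bullet> a) + 2 * (b \<bullet> b) -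
  4 * ((z - p) \<bullet> (z - p)), is at most 0.\<close>

lemma midpoint_fixed_point:
  fixes A B :: "'a::real_inner \<Rightarrow> 'a"
  assumes A: "1-lipschitz_on C A" and B: "1-lipschitz_on C B"
    and p: "p \<in> C" "A p = p" "B p = p"
    and z: "z \<in> C" "midpoint (A z) (B z) = z"
  shows "A z = z \<and> B z = z"
proof -
  define a b where "a = A z - p" and "b = B z - p"
  have zp: "z - p = (1/2) *\<^sub>R (a + b)"
    by (subst z(2)[symmetric]) (simp add: midpoint_def a_def b_def algebra_simps flip: scaleR_add_left)
  have "a \<bullet> a \<le> (z - p) \<bullet> (z - p)" "b \<bullet> b \<le> (z - p) \<bullet> (z - p)"
    using lipschitz_onD[OF A z(1) p(1)] lipschitz_onD[OF B z(1) p(1)] p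
    by (auto simp: a_def b_def dist_norm norm_le)
  then have "(a - b) \<bullet> (a - b) \<le> 0"
    unfolding zp
    by (simp add: inner_diff_left inner_diff_right inner_add_left inner_add_right inner_commute algebra_simps)
  then have "a = b"
    using inner_gt_zero_iff[of "a - b"] by (metis eq_iff_diff_eq_0 not_le)
  then have "A z = B z"
    by (simp add: a_def b_def)
  with z(2) show ?thesis
    by simp
qed

section \<open>Times at which the semigroup fixes a point\<close>

lemma semigroup_fixed_mult:
  fixes T :: "real \<Rightarrow> 'a \<Rightarrow> 'a"
  assumes sg: "\<And>s t. 0 \<le> s \<Longrightarrow> 0 \<le> t \<Longrightarrow> T (s + t) z = T s (T t z)"
    and a: "0 \<le> a" "T a z = z" and s: "0 \<le> s"
  shows "T (s + real k * a) z = T s z"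
proof (induction k)
  case (Suc k)
  have "T (s + real (Suc k) * a) z = T ((s + real k * a) + a) z"
    by (simp add: algebra_simps)
  also have "\<dots> = T (s + real k * a) z"
    using a s by (subst sg) auto
  finally show ?case
    using Suc by simp
qed simp

lemma semigroup_fixed_int_comb:
  fixes T :: "real \<Rightarrow> 'a \<Rightarrow> 'a"
  assumes sg: "\<And>s t. 0 \<le> s \<Longrightarrow> 0 \<le> t \<Longrightarrow> T (s + t) z = T s (T t z)"
    and a: "0 \<le> a" "T a z = z" and b: "0 \<le> b" "T b z = z"
    and ge: "0 \<le> of_int k * a + of_int h * b"
  shows "T (of_int k * a + of_int h * b) z = z"
proof -
  define s where "s = of_int k * a + of_int h * b"
  \<comment> \<open>T 0 need not be the identity, but z = T a z = T 0 (T a z) = T 0 z.\<close>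
  have "T 0 z = z"
    using sg[of 0 a] a by simp
  then have z: "T (real i * a + real j * b) z = z" for i j
    using semigroup_fixed_mult[OF sg a, of 0 i] semigroup_fixed_mult[OF sg b, of "real i * a" j] a(1)
    by simp
  have "0 \<le> s"
    using ge by (simp only: s_def)
  \<comment> \<open>Adding the negative parts of \<open>k\<close> and \<open>h\<close> to the time
    does not change the value, and leaves a combination with natural coefficients.\<close>
  then have "T s z = T (s + real (nat (-k)) * a) z"
    by (simp add: semigroup_fixed_mult[OF sg a])
  also have "\<dots> = T ((s + real (nat (-k)) * a) + real (nat (-h)) * b) z"
    using \<open>0 \<le> s\<close> a(1) by (simp add: semigroup_fixed_mult[OF sg b])
  also have "(s + real (nat (-k)) * a) + real (nat (-h)) * b = real (nat k) * a + real (nat h) * b"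
    unfolding s_def by (cases "0 \<le> k"; cases "0 \<le> h") simp_all
  also have "T (real (nat k) * a + real (nat h) * b) z = z"
    by (rule z)
  finally show ?thesis
    by (simp only: s_def)
qed

lemma semigroup_common_fixed_pointI:
  fixes T :: "real \<Rightarrow> 'e::banach \<Rightarrow> 'e"
  assumes \<tau>: "Hausdorff_space \<tau>" "topspace \<tau> = UNIV" and T: "nonexpansive_semigroup \<tau> C T"
    and \<alpha>\<beta>: "\<alpha> > 0" "\<beta> > 0" "\<alpha> / \<beta> \<notin> \<rat>"
    and z: "z \<in> C" "T \<alpha> z = z" "T \<beta> z = z"
  shows "common_fixed_point C T z"
proof -
  have sg: "T (s + t) z = T s (T t z)" if "0 \<le> s" "0 \<le> t" for s t
    using T z(1) that by (auto simp: nonexpansive_semigroup_def)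
  have cont: "continuous_map (top_of_set {0..}) (subtopology \<tau> C) (\<lambda>t. T t z)"
    using T z(1) by (auto simp: nonexpansive_semigroup_def)
  define F where "F = {t \<in> {0..}. T t z = z}"
  \<comment> \<open>This is where \<tau> enters: singletons are closed in a Hausdorff space, so
    their preimages under the orbit map are closed for the usual topology of the half-line.\<close>
  have "closedin (top_of_set {0..}) {t \<in> topspace (top_of_set {0..}). T t z \<in> {z}}"
  proof (rule closedin_continuous_map_preimage[OF cont])
    show "closedin (subtopology \<tau> C) {z}"
      using \<tau> z(1) by (simp add: closedin_Hausdorff_sing_eq Hausdorff_space_subtopology)
  qed
  then have "closedin (top_of_set {0..}) F"
    by (simp add: F_def)
  then have "closed F"
    using closedin_closed_trans closed_atLeast by blast
  have "t \<in> F" if "0 \<le> t" for t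
  proof -
    have "t \<in> closure F"
      unfolding closure_approachable
    proof (intro allI impI)
      fix e :: real assume e: "0 < e"
      \<comment> \<open>Aiming at t + d with error below \<open>d\<close> places \<open>s\<close>
        strictly between \<open>t\<close> and t + e, so \<open>s\<close> is a nonnegative time even
        for t = 0.\<close>
      define d where "d = e / 2"
      have "0 < d"
        using e by (simp add: d_def)
      then obtain h k :: int where hk: "\<bar>of_int k * (\<alpha> / \<beta>) - of_int h - (t + d) / \<beta>\<bar> < d / \<beta>"
        using sequence_of_fractional_parts_is_dense[OF \<alpha>\<beta>(3), of "d / \<beta>" "(t + d) / \<beta>"] \<alpha>\<beta>(2)
        by (metis divide_pos_pos)
      define s where "s = of_int k * \<alpha> + of_int (- h) * \<beta>"
      have "of_int k * (\<alpha> / \<beta>) - of_int h - (t + d) / \<beta> = (s - (t + d)) / \<beta>"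
        using \<alpha>\<beta> by (simp add: s_def field_simps)
      then have "\<bar>s - (t + d)\<bar> < d"
        using hk \<alpha>\<beta> by (simp add: abs_divide divide_less_cancel)
      then have "0 \<le> s" "dist s t < e"
        using that \<open>0 < d\<close> by (simp_all only: d_def dist_real_def)
      moreover have "T s z = z"
        using semigroup_fixed_int_comb[OF sg, of \<alpha> \<beta> k "- h"] \<alpha>\<beta> z \<open>0 \<le> s\<close> by (simp add: s_def)
      ultimately show "\<exists>s\<in>F. dist s t < e"
        by (auto simp: F_def)
    qed
    then show ?thesis
      using \<open>closed F\<close> by simp
  qed
  then show ?thesis
    using z(1) by (auto simp: common_fixed_point_def F_def)
qed

theorem theorem10:
  fixes \<tau> :: "'e::{real_inner, banach} topology"
    and C :: "'e set"
    and T :: "real \<Rightarrow> 'e \<Rightarrow> 'e"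
    and \<alpha> \<beta> :: real
    and u :: 'e
    and lam :: "nat \<Rightarrow> real"
    and x :: "nat \<Rightarrow> 'e"
  assumes "topspace \<tau> = UNIV" and "Hausdorff_space \<tau>"
    and "bounded C" and "closed C" and "convex C"
    and "nonexpansive_semigroup \<tau> C T"
    and "\<alpha> > 0" and "\<beta> > 0" and "\<alpha> / \<beta> \<notin> \<rat>"
    and "u \<in> C"
    and "\<forall>n\<ge>1. lam n \<in> {0<..<1}" and "lam \<longlonglongrightarrow> 0"
    and "\<forall>n\<ge>1. x n \<in> C"
    and "\<forall>n\<ge>1. x n = ((1 - lam n) / 2) *\<^sub>R T \<alpha> (x n)
                    + ((1 - lam n) / 2) *\<^sub>R T \<beta> (x n) + lam n *\<^sub>R u"
  shows "\<exists>z. common_fixed_point C T z \<and> x \<longlonglongrightarrow> z"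
proof -
  have T: "T t \<in> C \<rightarrow> C" "1-lipschitz_on C (T t)" if "0 \<le> t" for t
    using assms(6) that by (auto simp: nonexpansive_semigroup_def)
  define S where "S v = midpoint (T \<alpha> v) (T \<beta> v)" for v
  have S: "1-lipschitz_on C S"
    unfolding S_def[abs_def] using T assms(7,8) by (intro midpoint_nonexpansive) auto
  have SC: "S \<in> C \<rightarrow> C"
  proof
    fix v assume "v \<in> C"
    then have "T \<alpha> v \<in> C" "T \<beta> v \<in> C"
      using T(1)[of \<alpha>] T(1)[of \<beta>] assms(7,8) by auto
    then show "S v \<in> C"
      using convexD[OF assms(5), of _ _ "1/2" "1/2"] by (simp add: S_def midpoint_def scaleR_add_right)
  qed
  have S_half: "r *\<^sub>R S v = (r / 2) *\<^sub>R T \<alpha> v + (r / 2) *\<^sub>R T \<beta> v" for r v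
    by (simp add: S_def midpoint_def scaleR_add_right)
  \<comment> \<open>The hypotheses constrain \<open>x\<close> and \<open>lam\<close> only from index
    1 on, hence the shifted sequences.\<close>
  have "\<exists>z\<in>C. S z = z \<and> (\<lambda>n. x (Suc n)) \<longlonglongrightarrow> z"
  proof (rule approximants_converge[OF S SC assms(3,4)])
    show "(\<lambda>n. lam (Suc n)) \<longlonglongrightarrow> 0"
      using assms(12) by (rule LIMSEQ_Suc)
    show "x (Suc n) = (1 - lam (Suc n)) *\<^sub>R S (x (Suc n)) + lam (Suc n) *\<^sub>R u" for n
      unfolding S_half by (rule assms(14)[rule_format]) simp
  qed (use assms(11,13) in auto)
  then obtain z where z: "z \<in> C" "S z = z" "x \<longlonglongrightarrow> z"
    by (auto simp: filterlim_sequentially_Suc)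
  \<comment> \<open>Both sides equal T (\<alpha> + \<beta>) v.\<close>
  have "T \<alpha> (T \<beta> v) = T \<beta> (T \<alpha> v)" if "v \<in> C" for v
    using assms(6-8) that unfolding nonexpansive_semigroup_def by (metis add.commute less_imp_le)
  then obtain p where "p \<in> C" "T \<alpha> p = p" "T \<beta> p = p"
    using commuting_nonexpansive_common_fixed_point[of C "T \<alpha>" "T \<beta>"] T assms(3-5,7,8,10) by force
  then have "T \<alpha> z = z \<and> T \<beta> z = z"
    using T(2) assms(7,8) z(1,2) by (intro midpoint_fixed_point[of C _ _ p]) (auto simp: S_def)
  then show ?thesis
    using semigroup_common_fixed_pointI[OF assms(2,1,6-9) z(1)] z(3) by blast
qed

end
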